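(* Let $\mathscr D=\{d_1,\ldots,d_n\}$ be a set of positive integers with $d_1>d_2>\cdots>d_n$ such that $d_n$ divides $d$ for every $d\in\mathscr D$. Let $\mathbf s=d_1,\ldots,d_n$, let \[ c=\max_{1\le k\le n-1}\left\lceil \frac{-\Delta_{\mathbf s}(k)}{\min\{k,d_n\}}\right\rceil, \] and let \[ C^{\star}=\begin{cases} c & \text{if } d_n \text{ and } \sigma(\mathscr D) \text{ are even};\\ c & \text{if } d_n \text{ is odd and } \sigma(\mathscr D)+cd_n \text{ is even};\\ c+1 & \text{if } d_n \text{ and } \sigma(\mathscr D)+cd_n \text{ are odd}.\end{cases} \] Then \[ \ell_q(\mathscr D)=\tfrac12\big(\sigma(\mathscr D)+C^{\star}\min\mathscr D\big). \]
   Context: All graphs are finite and simple. The degree set of a graph $G$ is the set of distinct degrees of its vertices. For a finite nonempty set $\mathscr D$ of positive integers, $\ell_q(\mathscr D)$ denotes the least number of edges of a simple graph whose degree set is exactly $\mathscr D$. $\sigma(\mathscr D)$ is the sum of the elements of $\mathscr D$. For a sequence $\mathbf s=a_1,\ldots,a_p$ and $1\le k\le p$, define $\Delta_{\mathbf s}(k)=k(k-1)+\sum_{i=k+1}^{p}\min\{k,a_i\}-\sum_{i=1}^{k}a_i$. *)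

theory Defs
  imports Complex_Main
begin

definition simple_graph :: "'a set \<Rightarrow> 'a set set \<Rightarrow> bool" where
  "simple_graph V E \<longleftrightarrow> finite V \<and> (\<forall>e\<in>E. e \<subseteq> V \<and> card e = 2)"

definition degree :: "'a set set \<Rightarrow> 'a \<Rightarrow> nat" where
  "degree E v = card {e \<in> E. v \<in> e}"

definition degree_set :: "'a set \<Rightarrow> 'a set set \<Rightarrow> nat set" where
  "degree_set V E = degree E ` V"

text \<open>
  Every finite graph has an isomorphic copy with vertices in \<^typ>\<open>nat\<close>, so the vertex type in the
  following definition is no restriction; see \<open>l_q_le\<close> below.
\<close>

definition l_q :: "nat set \<Rightarrow> nat" where
  "l_q D = (LEAST m. \<exists>(V :: nat set) E. simple_graph V E \<and> degree_set V E = D \<and> card E = m)"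

definition sigma :: "nat set \<Rightarrow> nat" where
  "sigma D = \<Sum>D"

text \<open>The sequence \<open>a 1, \<dots>, a p\<close> is given by a function \<open>a\<close> together with its length \<open>p\<close>.\<close>

definition Delta :: "(nat \<Rightarrow> nat) \<Rightarrow> nat \<Rightarrow> nat \<Rightarrow> int" where
  "Delta a p k = int k * (int k - 1) + (\<Sum>i=k+1..p. int (min k (a i))) - (\<Sum>i=1..k. int (a i))"

text \<open>
  The last branch below is never reached when \<open>d\<close>, the least element of the degree set, divides
  all the others: if \<open>d\<close> is even then so is the sum \<open>s\<close>.
\<close>

definition C_star :: "nat \<Rightarrow> nat \<Rightarrow> int \<Rightarrow> int" where
  "C_star d s c =
    (if even d \<and> even s then c
     else if odd d \<and> even (int s + c * int d) then c
     else if odd d \<and> odd (int s + c * int d) then c + 1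
     else undefined)"

lemma simple_graph_nat_copy:
  assumes G: "simple_graph V E"
  obtains V' :: "nat set" and E' where
    "simple_graph V' E'" "degree_set V' E' = degree_set V E" "card E' = card E"
proof -
  from G have fin: "finite V" and sub: "\<And>e. e \<in> E \<Longrightarrow> e \<subseteq> V" and two: "\<And>e. e \<in> E \<Longrightarrow> card e = 2"
    by (auto simp: simple_graph_def)
  obtain f :: "'a \<Rightarrow> nat" where f: "inj_on f V"
    using finite_imp_inj_to_nat_seg[OF fin] by blast
  have inj: "inj_on ((`) f) E"
    using f sub by (meson inj_on_def inj_on_image_eq_iff)
  have "simple_graph (f ` V) ((`) f ` E)"
    unfolding simple_graph_def using fin sub two f
    by (auto simp: card_image inj_on_subset image_mono)
  moreover have "degree ((`) f ` E) (f v) = degree E v" if v: "v \<in> V" for v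
  proof -
    have "f v \<in> f ` e \<longleftrightarrow> v \<in> e" if "e \<in> E" for e
      using inj_on_image_mem_iff[OF f v sub[OF that]] .
    then have "{e \<in> (`) f ` E. f v \<in> e} = (`) f ` {e \<in> E. v \<in> e}"
      by blast
    moreover have "inj_on ((`) f) {e \<in> E. v \<in> e}"
      using inj by (rule inj_on_subset) auto
    ultimately show ?thesis by (simp add: degree_def card_image)
  qed
  then have "degree_set (f ` V) ((`) f ` E) = degree_set V E"
    by (simp add: degree_set_def image_image)
  moreover have "card ((`) f ` E) = card E"
    using inj by (rule card_image)
  ultimately show ?thesis by (rule that)
qed

lemma l_q_le:
  assumes "simple_graph V E" "degree_set V E = D"
  shows "l_q D \<le> card E"
proof -
  obtain V' :: "nat set" and E' where
    "simple_graph V' E'" "degree_set V' E' = degree_set V E" "card E' = card E"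
    using simple_graph_nat_copy[OF assms(1)] .
  with assms(2) show ?thesis
    unfolding l_q_def by (intro Least_le) blast
qed

end

theory Submission
  imports Defs
begin

text \<open>
  In a graph with degree set \<open>D\<close>, pick one vertex of each degree; the degrees of the remaining
  vertices sum to a multiple \<open>t d\<^sub>n\<close>. Counting the edges at the vertices of degrees \<open>d\<^sub>1, \<dots>, d\<^sub>k\<close>
  and using \<open>min k (q d\<^sub>n) \<le> q min k d\<^sub>n\<close> gives \<open>t min k d\<^sub>n \<ge> -\<Delta>(k)\<close>, hence \<open>t \<ge> c\<close>, and the parity of the
  degree sum improves this to \<open>t \<ge> C\<^sup>\<star>\<close>. Conversely, \<open>d\<^sub>1, \<dots>, d\<^sub>n\<close> followed by \<open>C\<^sup>\<star>\<close> further copies of \<open>d\<^sub>n\<close>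
  satisfies the Erdos-Gallai inequalities and is therefore the degree sequence of a graph.
  The sufficiency of these inequalities is shown by induction on the degree sum: lowering a largest
  entry and a smallest other positive entry by one preserves them, and a realization of the lowered
  sequence is repaired by adding one edge or switching.
\<close>

section \<open>Neighbourhoods, degrees and double counting\<close>

definition neighbours :: "'a set set \<Rightarrow> 'a \<Rightarrow> 'a set" where
  "neighbours E v = {u. {u, v} \<in> E}"

lemma neighbours_sym: "u \<in> neighbours E v \<longleftrightarrow> v \<in> neighbours E u"
  by (simp add: neighbours_def insert_commute)

lemma neighbours_subset:
  assumes "simple_graph V E"
  shows "neighbours E v \<subseteq> V - {v}"
  using assms by (fastforce simp: neighbours_def simple_graph_def)

lemma finite_edges: "simple_graph V E \<Longrightarrow> finite E"
  by (rule finite_subset[of _ "Pow V"]) (auto simp: simple_graph_def)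

lemma degree_eq_card_neighbours:
  assumes "simple_graph V E"
  shows "degree E v = card (neighbours E v)"
proof -
  have "bij_betw (\<lambda>u. {u, v}) (neighbours E v) {e \<in> E. v \<in> e}"
  proof (rule bij_betw_imageI)
    show "inj_on (\<lambda>u. {u, v}) (neighbours E v)"
      by (auto simp: inj_on_def doubleton_eq_iff)
    show "(\<lambda>u. {u, v}) ` neighbours E v = {e \<in> E. v \<in> e}"
    proof (intro equalityI subsetI)
      fix e assume e: "e \<in> {e \<in> E. v \<in> e}"
      then have "card e = 2" using assms by (auto simp: simple_graph_def)
      then obtain x y where "e = {x, y}" by (auto simp: card_2_iff)
      with e have "e = {x, v} \<or> e = {y, v}" by auto
      with e show "e \<in> (\<lambda>u. {u, v}) ` neighbours E v"
        by (auto simp: neighbours_def)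
    qed (auto simp: neighbours_def)
  qed
  then show ?thesis
    by (simp add: degree_def bij_betw_same_card)
qed

text \<open>Handshake lemma: every edge has exactly two ends in \<open>V\<close>, so counting
  incidences by edges gives twice their number.\<close>

lemma sum_degree_eq:
  assumes "simple_graph V E"
  shows "(\<Sum>v\<in>V. degree E v) = 2 * card E"
proof -
  have "\<forall>e\<in>E. card {v \<in> V. v \<in> e} = 2"
  proof
    fix e assume "e \<in> E"
    then have "{v \<in> V. v \<in> e} = e" "card e = 2"
      using assms by (auto simp: simple_graph_def)
    then show "card {v \<in> V. v \<in> e} = 2" by simp
  qed
  from sum_multicount[OF _ finite_edges[OF assms] this] assms
  show ?thesis by (simp add: degree_def simple_graph_def)
qed

lemma degree_insert_edge:
  assumes "finite E" "e \<notin> E"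
  shows "degree (insert e E) v = degree E v + of_bool (v \<in> e)"
proof -
  have "{e' \<in> insert e E. v \<in> e'} = (if v \<in> e then insert e {e' \<in> E. v \<in> e'} else {e' \<in> E. v \<in> e'})"
    by auto
  then show ?thesis using assms by (auto simp: degree_def)
qed

lemma degree_remove_edge:
  assumes "finite E" "e \<in> E"
  shows "degree E v = degree (E - {e}) v + of_bool (v \<in> e)"
  using degree_insert_edge[of "E - {e}" e v] assms by (simp add: insert_absorb)

text \<open>Necessity of the Erdos-Gallai inequality, for an arbitrary vertex set \<open>K\<close>.
  Double counting moves the sum to the other ends \<open>u\<close>: if \<open>u\<close> is in
  \<open>K\<close> it has at most \<open>card K - 1\<close> neighbours in \<open>K\<close>,
  otherwise at most \<open>card K\<close> and at most \<open>degree E u\<close>.\<close>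

lemma sum_degree_le:
  assumes G: "simple_graph V E" and K: "K \<subseteq> V"
  shows "(\<Sum>v\<in>K. degree E v) \<le> card K * (card K - 1) + (\<Sum>v\<in>V - K. min (card K) (degree E v))"
proof -
  have fin: "finite V" "finite K" using G K finite_subset by (auto simp: simple_graph_def)
  have fN: "finite (neighbours E u)" for u
    using neighbours_subset[OF G] fin by (meson finite_Diff finite_subset)
  have "(\<Sum>v\<in>K. degree E v) = (\<Sum>v\<in>K. card {u \<in> V. u \<in> neighbours E v})"
  proof (rule sum.cong[OF refl])
    fix v
    have "{u \<in> V. u \<in> neighbours E v} = neighbours E v"
      using neighbours_subset[OF G, of v] by blast
    then show "degree E v = card {u \<in> V. u \<in> neighbours E v}"
      by (simp add: degree_eq_card_neighbours[OF G])
  qed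
  also have "\<dots> = (\<Sum>u\<in>V. card {v \<in> K. u \<in> neighbours E v})"
    using sum_multicount_gen[OF fin(2,1), of "\<lambda>v u. u \<in> neighbours E v" "\<lambda>u. card {v \<in> K. u \<in> neighbours E v}"]
    by simp
  also have "\<dots> = (\<Sum>u\<in>V. card (K \<inter> neighbours E u))"
    by (intro sum.cong arg_cong[where f = card]) (use neighbours_sym in fast)+
  also have "\<dots> = (\<Sum>u\<in>K. card (K \<inter> neighbours E u)) + (\<Sum>u\<in>V - K. card (K \<inter> neighbours E u))"
    using sum.subset_diff[OF K fin(1)] by (simp add: add.commute)
  also have "\<dots> \<le> (\<Sum>u\<in>K. card K - 1) + (\<Sum>u\<in>V - K. min (card K) (degree E u))"
  proof (intro add_mono sum_mono)
    fix u assume u: "u \<in> K"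
    have "card (K \<inter> neighbours E u) \<le> card (K - {u})"
      using neighbours_subset[OF G, of u] fin by (intro card_mono) auto
    then show "card (K \<inter> neighbours E u) \<le> card K - 1" using u fin by simp
  next
    fix u
    show "card (K \<inter> neighbours E u) \<le> min (card K) (degree E u)"
      using fin fN[of u] by (simp add: degree_eq_card_neighbours[OF G] card_mono)
  qed
  finally show ?thesis by simp
qed

section \<open>Sufficiency of the Erdos-Gallai inequalities\<close>

text \<open>
  An order-free form of the Erdos-Gallai inequality: for fixed \<open>S\<close> of size \<open>k\<close>, the minimum of
  \<open>slack V a S T\<close> over \<open>T\<close> disjoint from \<open>S\<close> is attained at \<open>T = {i \<in> V - S. a i \<le> k}\<close> and equals
  \<open>k (k - 1) + (\<Sum>i\<in>V - S. min k (a i)) - (\<Sum>i\<in>S. a i)\<close>.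
\<close>

definition slack :: "'a set \<Rightarrow> ('a \<Rightarrow> nat) \<Rightarrow> 'a set \<Rightarrow> 'a set \<Rightarrow> int" where
  "slack V a S T = int (card S) * (int (card V) - 1 - int (card T)) + (\<Sum>i\<in>T. int (a i)) - (\<Sum>i\<in>S. int (a i))"

text \<open>Positivity of both entries makes the truncated subtractions exact, so the sum drops by
  one for each of \<open>x\<close> and \<open>y\<close> lying in \<open>A\<close>.\<close>

lemma sum_decrement:
  fixes a :: "'a \<Rightarrow> nat"
  assumes "finite A" "x \<noteq> y" "a x > 0" "a y > 0"
  shows "(\<Sum>i\<in>A. int ((a(x := a x - 1, y := a y - 1)) i))
    = (\<Sum>i\<in>A. int (a i)) - of_bool (x \<in> A) - of_bool (y \<in> A)"
proof -
  have "(\<Sum>i\<in>A. int ((a(x := a x - 1, y := a y - 1)) i))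
    = (\<Sum>i\<in>A. int (a i) - of_bool (i = x) - of_bool (i = y))"
    using assms by (intro sum.cong) auto
  also have "\<dots> = (\<Sum>i\<in>A. int (a i)) - of_bool (x \<in> A) - of_bool (y \<in> A)"
    using assms(1) by (simp add: sum_subtractf of_bool_def)
  finally show ?thesis .
qed

text \<open>Lowering \<open>x\<close> and \<open>y\<close> reduces the slack by at most 2, so a
  violation needs a pair \<open>S\<close>, \<open>T\<close> whose old slack is 0 or 1. Comparing
  with the slack after dropping \<open>x\<close> from \<open>T\<close> or adding it to
  \<open>S\<close> bounds the maximum \<open>M\<close>, which contradicts
  \<open>A \<le> k * M\<close>.\<close>

lemma slack_decrement_nonneg:
  fixes a :: "'a \<Rightarrow> nat"
  assumes fin: "finite V" and ev: "even (\<Sum>i\<in>V. a i)"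
    and EG: "\<And>S T. S \<subseteq> V \<Longrightarrow> T \<subseteq> V \<Longrightarrow> S \<inter> T = {} \<Longrightarrow> slack V a S T \<ge> 0"
    and x: "x \<in> V" "\<And>v. v \<in> V \<Longrightarrow> a v \<le> a x"
    and y: "y \<in> V" "y \<noteq> x" "a y > 0"
    and ST: "S \<subseteq> V" "T \<subseteq> V" "S \<inter> T = {}"
  shows "slack V (a(x := a x - 1, y := a y - 1)) S T \<ge> 0"
proof (rule ccontr)
  assume neg: "\<not> ?thesis"
  have fS: "finite S" and fT: "finite T" using ST fin by (auto intro: finite_subset)
  define p k l M where "p = int (card V)" and "k = int (card S)" and "l = int (card T)" and "M = int (a x)"
  define A B where "A = (\<Sum>i\<in>S. int (a i))" and "B = (\<Sum>i\<in>T. int (a i))"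
  have ax: "a x > 0" using y x(2)[of y] by simp
  have f: "slack V a S T = k * (p - 1 - l) + B - A"
    by (simp add: slack_def p_def k_def l_def A_def B_def)
  have f0: "k * (p - 1 - l) + B - A \<ge> 0" using EG[OF ST] f by simp
  have f': "k * (p - 1 - l) + B - A < of_bool (x \<in> T) + of_bool (y \<in> T) - of_bool (x \<in> S) - of_bool (y \<in> S)"
    using neg sum_decrement[OF fS _ ax y(3)] sum_decrement[OF fT _ ax y(3)] y(2)
    unfolding slack_def p_def k_def l_def A_def B_def
    by (auto simp del: fun_upd_apply)
  have M1: "M \<ge> 1" using ax by (simp add: M_def)
  have A_le: "A \<le> k * M"
    using sum_bounded_above[of S "\<lambda>i. int (a i)" M] x(2) ST by (auto simp: A_def k_def M_def)
  have k0: "k \<noteq> 0"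
  proof
    assume "k = 0"
    then have "S = {}" using fS by (simp add: k_def)
    then have "slack V (a(x := a x - 1, y := a y - 1)) S T \<ge> 0"
      by (auto simp: slack_def intro!: sum_nonneg)
    then show False using neg by simp
  qed
  then have k1: "k \<ge> 1" by (simp add: k_def)
  have card_ST: "card (S \<union> T) = card S + card T" using ST fS fT by (simp add: card_Un_disjoint)
  have kl: "k + l \<le> p"
    using card_mono[OF fin, of "S \<union> T"] ST card_ST by (simp add: k_def l_def p_def)
  have full: "S \<union> T = V" if "p = k + l"
    using that card_subset_eq[OF fin, of "S \<union> T"] card_ST ST by (simp add: k_def l_def p_def)
  have xT: "B \<ge> M" if "x \<in> T"
    using that fT member_le_sum[of x T "\<lambda>i. int (a i)"] by (simp add: B_def M_def)
  have xyT: "B \<ge> M + 1" if "x \<in> T" "y \<in> T"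
  proof -
    have "(\<Sum>i\<in>{x,y}. int (a i)) \<le> B"
      unfolding B_def using that fT by (intro sum_mono2) auto
    then show ?thesis using y by (simp add: M_def)
  qed
  \<comment> \<open>Removing \<open>x\<close> from \<open>T\<close> changes the slack by
    \<open>k - M\<close>, and the result is still nonnegative.\<close>
  have M_le: "M \<le> k * (p - 1 - l) + B - A + k" if "x \<in> T"
  proof -
    have "card T > 0" using that fT by (auto simp: card_gt_0_iff)
    then have "slack V a S (T - {x}) = k * (p - 1 - l) + B - A + k - M"
      using that fT
      by (simp add: slack_def p_def k_def l_def A_def B_def M_def sum_diff1 algebra_simps)
    moreover have "slack V a S (T - {x}) \<ge> 0" using ST by (intro EG) auto
    ultimately show ?thesis by simp
  qed
  show False
  proof (cases "x \<in> T")
    case True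
    then have xS: "x \<notin> S" using ST by auto
    have yS: "y \<notin> S" using f' f0 True xS ST by (cases "y \<in> T") auto
    consider "k * (p - 1 - l) + B - A = 0" | "k * (p - 1 - l) + B - A = 1" "y \<in> T"
      using f' f0 True xS yS by (cases "y \<in> T"; simp; linarith)
    then show False
    proof cases
      case 1
      then have Mk: "M \<le> k" using M_le True by simp
      \<comment> \<open>Here \<open>A - B \<le> k * M - M\<close>, which is below
        \<open>k * k\<close>. This forces \<open>S\<close> and \<open>T\<close> to cover
        \<open>V\<close>, so that \<open>y\<close> lies in \<open>T\<close> and \<open>B\<close>
        gains one more unit.\<close>
      have "k * (p - 1 - l) < k * k"
        using 1 A_le Mk xT[OF True] M1 mult_left_mono[OF Mk, of k] k1 by linarith
      then have "p - 1 - l < k" using k1 by (simp add: mult_less_cancel_left)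
      then have p: "p = k + l" using kl by simp
      then have "y \<in> T" using full y yS by auto
      then have B: "B \<ge> M + 1" using xyT True by simp
      have "k * (k - 1) + M + 1 \<le> k * M" using 1 p B A_le by (simp add: algebra_simps)
      moreover have "(k - 1) * M \<le> (k - 1) * k" using Mk k1 by (intro mult_left_mono) auto
      ultimately show False by (simp add: algebra_simps)
    next
      case 2
      have B: "B \<ge> M + 1" using xyT True 2 by simp
      have Mk: "M \<le> k + 1" using M_le[OF True] 2 by simp
      show False
      proof (cases "p = k + l")
        case True
        \<comment> \<open>Parity excludes slack 1 when \<open>S\<close> and \<open>T\<close> cover
          \<open>V\<close>: the slack is then \<open>k * (k - 1) + B - A\<close>, where
          \<open>A + B\<close> is the even total.\<close>
        have "A + B = (\<Sum>i\<in>V. int (a i))"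
          unfolding A_def B_def full[OF True, symmetric]
          using ST fS fT by (simp add: sum.union_disjoint)
        then have "even (A + B)" using ev by (simp flip: of_nat_sum)
        moreover have "even (k * (k - 1))" by simp
        then obtain z where "k * (k - 1) = 2 * z" by (rule evenE)
        then have "2 * z + B - A = 1" using 2 True by simp
        ultimately show False by presburger
      next
        case False
        then have "k * k \<le> k * (p - 1 - l)" using kl k1 by (intro mult_left_mono) auto
        then have "k * k + M \<le> k * M" using 2 B A_le by linarith
        moreover have "(k - 1) * M \<le> (k - 1) * (k + 1)" using Mk k1 by (intro mult_left_mono) auto
        ultimately show False by (simp add: algebra_simps)
      qed
    qed
  next
    case False
    then have yT: "y \<in> T" and xS: "x \<notin> S" and z: "k * (p - 1 - l) + B - A = 0"
      using f' f0 ST by (auto split: if_splits simp: of_bool_def)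
    \<comment> \<open>Adding \<open>x\<close> to \<open>S\<close> changes the slack by
      \<open>p - 1 - l - M\<close>. As the old slack is 0, \<open>M \<le> p - 1 - l\<close>, and the
      positive entry at \<open>y\<close> in \<open>T\<close> then makes the slack positive.\<close>
    have "slack V a (insert x S) T = k * (p - 1 - l) + B - A + (p - 1 - l) - M"
      using xS fS by (simp add: slack_def p_def k_def l_def A_def B_def M_def algebra_simps)
    moreover have "slack V a (insert x S) T \<ge> 0" using ST x False by (intro EG) auto
    ultimately have "M \<le> p - 1 - l" using z by simp
    then have "k * M \<le> k * (p - 1 - l)" using k1 by (intro mult_left_mono) auto
    moreover have "B \<ge> int (a y)"
      using yT fT member_le_sum[of y T "\<lambda>i. int (a i)"] by (simp add: B_def)
    ultimately show False using A_le z y by linarith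
  qed
qed

text \<open>If \<open>x\<close> and \<open>y\<close> are already adjacent, the edge \<open>rs\<close> is replaced by \<open>xr\<close> and \<open>sy\<close>.\<close>

lemma increment_degrees:
  assumes G: "simple_graph V E" and xy: "x \<in> V" "y \<in> V" "x \<noteq> y"
    and r: "r \<in> V" "r \<noteq> x" "r \<notin> neighbours E x" "r \<noteq> y \<Longrightarrow> degree E y < degree E r"
  obtains E' where "simple_graph V E'"
    "\<And>v. degree E' v = degree E v + of_bool (v = x) + of_bool (v = y)"
proof (cases "{x, y} \<in> E")
  case False
  show ?thesis
  proof (rule that)
    show "simple_graph V (insert {x, y} E)"
      using G xy by (auto simp: simple_graph_def)
    show "degree (insert {x, y} E) v = degree E v + of_bool (v = x) + of_bool (v = y)" for v
      using degree_insert_edge[OF finite_edges[OF G] False, of v] xy by auto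
  qed
next
  case True
  have fin: "finite E" using finite_edges[OF G] .
  have fN: "finite (neighbours E u)" for u
    using neighbours_subset[OF G] G by (meson finite_Diff finite_subset simple_graph_def)
  \<comment> \<open>The edge \<open>xy\<close> makes \<open>y\<close> a neighbour of
    \<open>x\<close>, which \<open>r\<close> is not, so the degree comparison of \<open>r\<close>
    and \<open>y\<close> is available.\<close>
  have ry: "r \<noteq> y" using r True by (auto simp: neighbours_def insert_commute)
  \<comment> \<open>Adjacency of \<open>r\<close> and \<open>y\<close> is symmetric, so either both
    neighbourhoods lose a vertex or neither does, and the strict inequality survives.\<close>
  have "card (neighbours E y - {r}) < card (neighbours E r - {y})"
    using r(4)[OF ry] fN neighbours_sym[of r E y]
    by (simp add: degree_eq_card_neighbours[OF G] card_Diff_singleton_if card_gt_0_iff)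
      (metis Suc_pred card_gt_0_iff empty_iff not_less_eq)
  then have "\<not> neighbours E r - {y} \<subseteq> neighbours E y - {r}"
    using fN by (meson card_mono finite_Diff leD)
  then obtain s where s: "s \<in> neighbours E r" "s \<noteq> y" "s \<notin> neighbours E y"
    using neighbours_subset[OF G, of r] by blast
  have sr: "s \<noteq> r" "s \<in> V" using s neighbours_subset[OF G, of r] by auto
  have sx: "s \<noteq> x" using s True by (auto simp: neighbours_def)
  \<comment> \<open>In the switch \<open>r\<close> and \<open>s\<close> lose one edge and gain one
    each, so only \<open>x\<close> and \<open>y\<close> gain degree.\<close>
  define E1 where "E1 = E - {{r, s}}"
  define E2 where "E2 = insert {x, r} E1"
  have rs: "{r, s} \<in> E" using s by (simp add: neighbours_def insert_commute)
  have e1: "{x, r} \<notin> E1" using r by (auto simp: E1_def neighbours_def insert_commute)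
  have e2: "{s, y} \<notin> E2" using s sx xy by (auto simp: E1_def E2_def neighbours_def doubleton_eq_iff)
  have fin1: "finite E1" and fin2: "finite E2" using fin by (auto simp: E1_def E2_def)
  show ?thesis
  proof (rule that)
    show "simple_graph V (insert {s, y} E2)"
      using G xy r s sr by (auto simp: simple_graph_def E1_def E2_def)
    show "degree (insert {s, y} E2) v = degree E v + of_bool (v = x) + of_bool (v = y)" for v
      using degree_insert_edge[OF fin2 e2, of v] degree_insert_edge[OF fin1 e1, of v]
        degree_remove_edge[OF fin rs, of v] sr sx s(2) ry r(2) xy(3)
      unfolding E1_def[symmetric] E2_def[symmetric] by (auto simp: of_bool_def)
  qed
qed

text \<open>Quantifying over all disjoint \<open>S\<close>, \<open>T\<close> avoids sorting the
  entries again after two of them have been lowered.\<close>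

theorem Erdos_Gallai_sufficiency:
  fixes a :: "'a \<Rightarrow> nat"
  assumes fin: "finite V" and ev: "even (\<Sum>i\<in>V. a i)"
    and EG: "\<And>S T. S \<subseteq> V \<Longrightarrow> T \<subseteq> V \<Longrightarrow> S \<inter> T = {} \<Longrightarrow> slack V a S T \<ge> 0"
  shows "\<exists>E. simple_graph V E \<and> (\<forall>v\<in>V. degree E v = a v)"
  using ev EG
proof (induction "\<Sum>i\<in>V. a i" arbitrary: a rule: less_induct)
  case less
  show ?case
  proof (cases "\<forall>v\<in>V. a v = 0")
    case True
    then have "simple_graph V {} \<and> (\<forall>v\<in>V. degree {} v = a v)"
      using fin by (simp add: simple_graph_def degree_def)
    then show ?thesis by blast
  next
    case False
    then have "V \<noteq> {}" by auto
    then have "Max (a ` V) \<in> a ` V" using fin by (intro Max_in) auto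
    then obtain x where xV: "x \<in> V" and "a x = Max (a ` V)" by auto
    then have x: "x \<in> V" "\<And>v. v \<in> V \<Longrightarrow> a v \<le> a x"
      using fin by auto
    have ax: "a x > 0" using False x(2) by (metis gr0I le_zero_eq)
    define P where "P = {v \<in> V. a v > 0}"
    have finP: "finite P" using fin by (simp add: P_def)
    have xP: "x \<in> P" using x ax by (simp add: P_def)
    \<comment> \<open>This instance says that \<open>x\<close> has at least \<open>a x\<close> other
      vertices of positive prescribed degree available.\<close>
    have "slack V a {x} (V - P) \<ge> 0"
      using x ax by (intro less.prems) (auto simp: P_def)
    moreover have "(\<Sum>i\<in>V - P. int (a i)) = 0" by (intro sum.neutral) (auto simp: P_def)
    moreover have "card (V - P) = card V - card P" "card P \<le> card V"
      using fin finP by (auto simp: card_Diff_subset P_def intro: card_mono)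
    ultimately have aP: "a x \<le> card (P - {x})"
      using xP finP by (simp add: slack_def)
    then have "P - {x} \<noteq> {}" using ax by (metis card.empty leD)
    then have "Min (a ` (P - {x})) \<in> a ` (P - {x})" using finP by (intro Min_in) auto
    then obtain y where yP: "y \<in> P - {x}" and "a y = Min (a ` (P - {x}))"
      by (metis imageE)
    then have y: "y \<in> P - {x}" "\<And>v. v \<in> P - {x} \<Longrightarrow> a y \<le> a v"
      using finP by auto
    then have yV: "y \<in> V" "y \<noteq> x" "a y > 0" by (auto simp: P_def)
    define b where "b = a(x := a x - 1, y := a y - 1)"
    have "(\<Sum>i\<in>V. int (b i)) = (\<Sum>i\<in>V. int (a i)) - 2"
      unfolding b_def using sum_decrement[OF fin _ ax yV(3)] x yV by auto
    then have sb: "(\<Sum>i\<in>V. b i) + 2 = (\<Sum>i\<in>V. a i)"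
      by (simp flip: of_nat_sum)
    have "even (\<Sum>i\<in>V. b i)" using less.prems(1) by (simp flip: sb)
    moreover have "slack V b S T \<ge> 0" if "S \<subseteq> V" "T \<subseteq> V" "S \<inter> T = {}" for S T
      unfolding b_def using slack_decrement_nonneg[OF fin less.prems x yV that] by blast
    ultimately obtain E where E: "simple_graph V E" "\<forall>v\<in>V. degree E v = b v"
      using less.hyps[of b] sb by auto
    have fN: "finite (neighbours E u)" for u
      using neighbours_subset[OF E(1)] fin by (meson finite_Diff finite_subset)
    \<comment> \<open>In \<open>E\<close> the degree of \<open>x\<close> is only
      \<open>a x - 1\<close>, so some other vertex \<open>r\<close> of \<open>P\<close> is not
      adjacent to \<open>x\<close>.\<close>
    have "card (neighbours E x) < card (P - {x})"
      using E x yV aP ax by (simp add: b_def degree_eq_card_neighbours[OF E(1), symmetric])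
    then have "\<not> P - {x} \<subseteq> neighbours E x"
      using fN by (meson card_mono leD)
    then obtain r where r: "r \<in> P" "r \<noteq> x" "r \<notin> neighbours E x" by blast
    \<comment> \<open>This is where the minimal choice of \<open>y\<close> enters:
      \<open>degree E r = a r \<ge> a y\<close>, while \<open>y\<close> was lowered to
      \<open>a y - 1\<close>.\<close>
    have "degree E y < degree E r" if "r \<noteq> y"
      using that r y(2)[of r] E(2) yV by (auto simp: b_def P_def)
    then obtain E' where E': "simple_graph V E'"
      "\<And>v. degree E' v = degree E v + of_bool (v = x) + of_bool (v = y)"
      using increment_degrees[OF E(1) x(1) yV(1) yV(2)[symmetric], of r] r by (auto simp: P_def)
    have "\<forall>v\<in>V. degree E' v = a v"
      using E'(2) E(2) ax yV by (auto simp: b_def)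
    then show ?thesis using E'(1) by blast
  qed
qed

section \<open>Ordered sequences and constant tails\<close>

text \<open>Exchange argument: \<open>S - {1..k}\<close> and \<open>{1..k} - S\<close> have equal
  size, and \<open>g k\<close> separates the values on them.\<close>

lemma sum_le_sum_initial:
  fixes g :: "nat \<Rightarrow> int"
  assumes anti: "\<And>i j. 1 \<le> i \<Longrightarrow> i \<le> j \<Longrightarrow> j \<le> p \<Longrightarrow> g j \<le> g i"
    and S: "S \<subseteq> {1..p}" and k: "card S = k"
  shows "sum g S \<le> sum g {1..k}"
proof (cases "k = 0")
  case True
  then show ?thesis using S k finite_subset by fastforce
next
  case False
  have fS: "finite S" using S finite_subset by blast
  have kp: "k \<le> p" using card_mono[OF _ S] k by simp
  have c: "card (S - {1..k}) = card ({1..k} - S)"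
    using card_Diff_subset_Int[of S "{1..k}"] card_Diff_subset_Int[of "{1..k}" S] fS k
    by (simp add: Int_commute)
  have "sum g (S - {1..k}) \<le> of_nat (card (S - {1..k})) * g k"
    using S False by (intro sum_bounded_above anti) auto
  also have "\<dots> \<le> sum g ({1..k} - S)"
    unfolding c using kp by (intro sum_bounded_below anti) auto
  finally have "sum g (S - {1..k}) \<le> sum g ({1..k} - S)" .
  moreover have "sum g S = sum g (S - {1..k}) + sum g (S \<inter> {1..k})"
    using sum.Int_Diff[OF fS, of g "{1..k}"] by simp
  moreover have "sum g {1..k} = sum g ({1..k} - S) + sum g (S \<inter> {1..k})"
    using sum.Int_Diff[of "{1..k}" g S] by (simp add: Int_commute)
  ultimately show ?thesis by simp
qed

text \<open>With \<open>m i = min k (a i)\<close>, \<open>Delta a p k \<ge> 0\<close> bounds the sum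
  of \<open>a + m\<close> over \<open>{1..k}\<close> by \<open>k * (k - 1)\<close> plus the sum of
  \<open>m\<close> over all indices. As \<open>a + m\<close> is decreasing, the same bound holds for
  every \<open>S\<close> of size \<open>k\<close>; then \<open>m\<close> is estimated by
  \<open>a\<close> on \<open>T\<close> and by \<open>k\<close> on the remaining indices.\<close>

lemma slack_nonneg_if_Delta_nonneg:
  fixes a :: "nat \<Rightarrow> nat"
  assumes anti: "\<And>i j. 1 \<le> i \<Longrightarrow> i \<le> j \<Longrightarrow> j \<le> p \<Longrightarrow> a j \<le> a i"
    and EG: "\<And>k. 1 \<le> k \<Longrightarrow> k \<le> p \<Longrightarrow> Delta a p k \<ge> 0"
    and ST: "S \<subseteq> {1..p}" "T \<subseteq> {1..p}" "S \<inter> T = {}"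
  shows "slack {1..p} a S T \<ge> 0"
proof (cases "S = {}")
  case True
  then show ?thesis by (auto simp: slack_def intro!: sum_nonneg)
next
  case False
  have fS: "finite S" and fT: "finite T" using ST by (auto intro: finite_subset)
  define k l where "k = card S" and "l = card T"
  define m where "m i = int (min k (a i))" for i
  have k1: "1 \<le> k" using False fS by (simp add: k_def Suc_le_eq card_gt_0_iff)
  have kp: "k \<le> p" using card_mono[OF _ ST(1)] by (simp add: k_def)
  have "(\<Sum>i\<in>S. int (a i) + m i) \<le> (\<Sum>i=1..k. int (a i) + m i)"
  proof (rule sum_le_sum_initial[OF _ ST(1)])
    show "int (a j) + m j \<le> int (a i) + m i" if "1 \<le> i" "i \<le> j" "j \<le> p" for i j
      using anti[OF that] by (simp add: m_def)
  qed (simp add: k_def)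
  then have 1: "(\<Sum>i\<in>S. int (a i)) + sum m S \<le> (\<Sum>i=1..k. int (a i)) + sum m {1..k}"
    by (simp add: sum.distrib)
  have "{1..p} = {1..k} \<union> {k+1..p}" using k1 kp by auto
  then have 2: "sum m {1..p} = sum m {1..k} + sum m {k+1..p}"
    by (metis (no_types, lifting) Suc_eq_plus1 finite_atLeastAtMost ivl_disj_int_two(8) atLeastSucAtMost_greaterThanAtMost sum.union_disjoint)
  define R where "R = {1..p} - (S \<union> T)"
  have "sum m {1..p} = sum m R + sum m (S \<union> T)"
    unfolding R_def using ST by (intro sum.subset_diff) auto
  then have 3: "sum m {1..p} = sum m S + sum m T + sum m R"
    using ST fS fT by (simp add: sum.union_disjoint)
  have cR: "int (card R) = int p - int k - int l"
  proof -
    have "card (S \<union> T) = k + l" using ST fS fT by (simp add: card_Un_disjoint k_def l_def)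
    moreover have "card (S \<union> T) \<le> p" using card_mono[of "{1..p}" "S \<union> T"] ST by simp
    ultimately show ?thesis
      using ST fS fT by (simp add: R_def card_Diff_subset)
  qed
  have 4: "sum m R \<le> int (card R) * int k"
    using sum_bounded_above[of R m "int k"] by (simp add: m_def)
  have 5: "sum m T \<le> (\<Sum>i\<in>T. int (a i))" by (intro sum_mono) (simp add: m_def)
  have 6: "int k * (int k - 1) + sum m {k+1..p} - (\<Sum>i=1..k. int (a i)) \<ge> 0"
    using EG[OF k1 kp] unfolding Delta_def m_def .
  have "int k * (int k - 1) + int (card R) * int k = int k * (int p - 1 - int l)"
    unfolding cR by (simp add: algebra_simps)
  then show ?thesis using 1 2 3 4 5 6
    unfolding slack_def k_def[symmetric] l_def[symmetric] by simp
qed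

text \<open>Each appended entry contributes \<open>min k m\<close>; for \<open>m = d n\<close> this
  is the denominator in the formula for \<open>c\<close>.\<close>

lemma Delta_extend:
  assumes "k \<le> n"
  shows "Delta (\<lambda>i. if i \<le> n then d i else m) (n + C) k = Delta d n k + int C * int (min k m)"
proof -
  let ?a = "\<lambda>i. if i \<le> n then d i else m"
  have "(\<Sum>i=k+1..n+C. int (min k (?a i)))
    = (\<Sum>i=k+1..n. int (min k (?a i))) + (\<Sum>i=n+1..n+C. int (min k (?a i)))"
    using assms by (intro sum.ub_add_nat) simp
  also have "(\<Sum>i=k+1..n. int (min k (?a i))) = (\<Sum>i=k+1..n. int (min k (d i)))"
    by (intro sum.cong) auto
  also have "(\<Sum>i=n+1..n+C. int (min k (?a i))) = (\<Sum>i=n+1..n+C. int (min k m))"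
    by (intro sum.cong) auto
  also have "\<dots> = int C * int (min k m)" by simp
  finally have "(\<Sum>i=k+1..n+C. int (min k (?a i)))
    = (\<Sum>i=k+1..n. int (min k (d i))) + int C * int (min k m)" .
  moreover have "(\<Sum>i=1..k. int (?a i)) = (\<Sum>i=1..k. int (d i))"
    using assms by (intro sum.cong) auto
  ultimately show ?thesis by (simp add: Delta_def)
qed

text \<open>Only the inequalities with \<open>k \<le> n - 1\<close> have to be checked. Up to
  \<open>m\<close> all of them follow from the case \<open>k = 1\<close>, and from
  \<open>max m (n - 1)\<close> on \<open>Delta\<close> is nondecreasing.\<close>

lemma Delta_constant_tail_nonneg:
  fixes a :: "nat \<Rightarrow> nat"
  assumes n: "n \<ge> 2" and m: "m > 0"
    and anti: "\<And>i j. 1 \<le> i \<Longrightarrow> i \<le> j \<Longrightarrow> j \<le> p \<Longrightarrow> a j \<le> a i"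
    and tail: "\<And>i. n \<le> i \<Longrightarrow> i \<le> p \<Longrightarrow> a i = m"
    and np: "n \<le> p"
    and EG: "\<And>k. 1 \<le> k \<Longrightarrow> k \<le> n - 1 \<Longrightarrow> Delta a p k \<ge> 0"
    and k: "1 \<le> k" "k \<le> p"
  shows "Delta a p k \<ge> 0"
proof -
  have ge_m: "m \<le> a i" if "1 \<le> i" "i \<le> p" for i
    using anti[of i p] tail[of p] that np by simp
  have small: "Delta a p j = int j * (int p - 1) - (\<Sum>i=1..j. int (a i))" if "j \<le> m" "j \<le> p" for j
  proof -
    have "(\<Sum>i=j+1..p. int (min j (a i))) = (\<Sum>i=j+1..p. int j)"
      using that ge_m by (intro sum.cong) (auto simp: min_def intro: antisym order_trans)
    also have "\<dots> = (int p - int j) * int j" using that by simp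
    finally show ?thesis by (simp add: Delta_def algebra_simps)
  qed
  have "Delta a p 1 \<ge> 0" using n by (intro EG) auto
  then have a1: "int (a 1) \<le> int p - 1" using small[of 1] m n np by simp
  have le_m: "Delta a p j \<ge> 0" if "1 \<le> j" "j \<le> m" "j \<le> p" for j
  proof -
    have "(\<Sum>i=1..j. int (a i)) \<le> of_nat (card {1..j}) * (int p - 1)"
    proof (rule sum_bounded_above)
      fix i assume "i \<in> {1..j}"
      then have "a i \<le> a 1" using anti[of 1 i] that by simp
      then show "int (a i) \<le> int p - 1" using a1 by simp
    qed
    then show ?thesis using small that by simp
  qed
  have large: "Delta a p j = int j * (int j - 1) + (int p - int j) * int m - (\<Sum>i=1..j. int (a i))"
    if "m \<le> j" "n - 1 \<le> j" "j \<le> p" for j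
  proof -
    have "(\<Sum>i=j+1..p. int (min j (a i))) = (\<Sum>i=j+1..p. int m)"
      using that tail by (intro sum.cong) auto
    also have "\<dots> = (int p - int j) * int m" using that by simp
    finally show ?thesis by (simp add: Delta_def)
  qed
  show ?thesis
  proof (cases "k \<le> m \<or> k \<le> n - 1")
    case True
    then show ?thesis using le_m EG k by blast
  next
    case False
    \<comment> \<open>From \<open>j0\<close> on, all later entries equal \<open>m\<close> and are
      not cut off by the minimum, so the closed form \<open>large\<close> applies.\<close>
    define j0 where "j0 = max m (n - 1)"
    have j0: "m \<le> j0" "n - 1 \<le> j0" "1 \<le> j0" "j0 \<le> k" using False m by (auto simp: j0_def)
    have base: "Delta a p j0 \<ge> 0"
    proof (cases "m \<le> n - 1")
      case True
      then show ?thesis using EG n by (simp add: j0_def max_def)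
    next
      case False
      then show ?thesis using le_m m j0 k by (simp add: j0_def max_def)
    qed
    from j0(4) k(2) show ?thesis
    proof (induction k rule: dec_induct)
      case base
      show ?case by fact
    next
      case (step j)
      have "a (Suc j) = m" using step j0 by (intro tail) auto
      then have "Delta a p (Suc j) = Delta a p j + 2 * (int j - int m)"
        using large[of j] large[of "Suc j"] step j0 by (simp add: algebra_simps)
      then show ?case using step j0 by simp
    qed
  qed
qed

section \<open>Lower bound and construction for a degree set\<close>

text \<open>\<open>t\<close> measures, in units of \<open>m\<close>, the total degree outside a set
  of representatives, one for each \<open>d i\<close>. The inequalities are the Erdos-Gallai bound
  applied to the first \<open>k\<close> representatives.\<close>

lemma edges_of_degree_set:
  assumes G: "simple_graph V E" and D: "degree_set V E = d ` {1..n}"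
    and inj: "inj_on d {1..n}" and dvd: "\<And>i. i \<in> {1..n} \<Longrightarrow> m dvd d i"
  obtains t where "2 * card E = (\<Sum>i=1..n. d i) + t * m"
    "\<And>k. 1 \<le> k \<Longrightarrow> k \<le> n \<Longrightarrow> - Delta d n k \<le> int t * int (min k m)"
proof -
  have fin: "finite V" using G by (simp add: simple_graph_def)
  have "\<forall>i\<in>{1..n}. \<exists>v. v \<in> V \<and> degree E v = d i"
  proof
    fix i assume "i \<in> {1..n}"
    then have "d i \<in> degree_set V E" unfolding D by (rule imageI)
    then show "\<exists>v. v \<in> V \<and> degree E v = d i" by (auto simp: degree_set_def)
  qed
  then obtain v where v: "\<And>i. i \<in> {1..n} \<Longrightarrow> v i \<in> V" "\<And>i. i \<in> {1..n} \<Longrightarrow> degree E (v i) = d i"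
    by metis
  have vinj: "inj_on v {1..n}" using inj v(2) by (metis (no_types, lifting) inj_on_def)
  define X where "X = V - v ` {1..n}"
  have XV: "finite X" using fin by (simp add: X_def)
  \<comment> \<open>Every degree is some \<open>d i\<close>, hence a multiple of \<open>m\<close>,
    so this division is exact on \<open>X\<close>.\<close>
  define q where "q x = degree E x div m" for x
  have q: "degree E x = q x * m" if "x \<in> X" for x
  proof -
    have "degree E x \<in> degree_set V E" using that by (auto simp: X_def degree_set_def)
    then show ?thesis using D dvd by (auto simp: q_def)
  qed
  define t where "t = sum q X"
  have sum_v: "(\<Sum>x\<in>v ` I. f (degree E x)) = (\<Sum>i\<in>I. f (d i))" if "I \<subseteq> {1..n}" for I and f :: "nat \<Rightarrow> nat"
    using that v(2) inj_on_subset[OF vinj that] by (simp add: sum.reindex subset_iff)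
  show ?thesis
  proof (rule that)
    have "2 * card E = (\<Sum>x\<in>V. degree E x)" using sum_degree_eq[OF G] by simp
    also have "\<dots> = (\<Sum>x\<in>X. degree E x) + (\<Sum>x\<in>v ` {1..n}. degree E x)"
      unfolding X_def using v(1) by (intro sum.subset_diff fin) auto
    also have "(\<Sum>x\<in>X. degree E x) = t * m" by (simp add: t_def sum_distrib_right q)
    finally show "2 * card E = (\<Sum>i=1..n. d i) + t * m"
      using sum_v[of "{1..n}" "\<lambda>x. x"] by simp
  next
    fix k assume k: "1 \<le> k" "k \<le> n"
    define K where "K = v ` {1..k}"
    have KV: "K \<subseteq> V" using v(1) k by (auto simp: K_def)
    have cK: "card K = k"
      unfolding K_def using inj_on_subset[OF vinj, of "{1..k}"] k by (simp add: card_image)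
    have "V - K = v ` {k+1..n} \<union> X"
    proof -
      have "v ` {1..n} = v ` {1..k} \<union> v ` {k+1..n}"
        using k by (subst image_Un[symmetric], intro arg_cong[where f = "(`) v"]) auto
      moreover have "v ` {1..k} \<inter> v ` {k+1..n} = {}"
        using inj_on_image_Int[OF vinj, of "{1..k}" "{k+1..n}"] k by auto
      moreover have "v ` {1..n} \<subseteq> V" using v(1) by auto
      ultimately show ?thesis unfolding X_def K_def by blast
    qed
    moreover have "v ` {k+1..n} \<inter> X = {}" using k by (auto simp: X_def)
    ultimately have "(\<Sum>x\<in>V - K. min k (degree E x))
      = (\<Sum>x\<in>v ` {k+1..n}. min k (degree E x)) + (\<Sum>x\<in>X. min k (degree E x))"
      using XV by (simp add: sum.union_disjoint)
    also have "(\<Sum>x\<in>v ` {k+1..n}. min k (degree E x)) = (\<Sum>i=k+1..n. min k (d i))"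
      using k by (intro sum_v) auto
    \<comment> \<open>A vertex of degree \<open>q x * m\<close> contributes no more than
      \<open>q x\<close> vertices of degree \<open>m\<close> would.\<close>
    also have "(\<Sum>x\<in>X. min k (degree E x)) \<le> (\<Sum>x\<in>X. q x * min k m)"
    proof (rule sum_mono)
      fix x assume "x \<in> X"
      then show "min k (degree E x) \<le> q x * min k m"
        using q[of x] by (cases "q x") (auto simp: min_def)
    qed
    also have "\<dots> = t * min k m" by (simp add: t_def sum_distrib_right)
    finally have "(\<Sum>x\<in>V - K. min k (degree E x)) \<le> (\<Sum>i=k+1..n. min k (d i)) + t * min k m"
      by simp
    moreover have "(\<Sum>x\<in>K. degree E x) = (\<Sum>i=1..k. d i)"
      using sum_v[of "{1..k}" "\<lambda>x. x"] k by (simp add: K_def)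
    ultimately have "(\<Sum>i=1..k. d i) \<le> k * (k - 1) + ((\<Sum>i=k+1..n. min k (d i)) + t * min k m)"
      using sum_degree_le[OF G KV] cK by simp
    then have "int (\<Sum>i=1..k. d i) \<le> int (k * (k - 1) + ((\<Sum>i=k+1..n. min k (d i)) + t * min k m))"
      by (simp only: of_nat_le_iff)
    then show "- Delta d n k \<le> int t * int (min k m)"
      using k by (simp add: Delta_def)
  qed
qed

text \<open>Appending copies of \<open>d n\<close> keeps the degree set and the decreasing order,
  and \<open>EG\<close> is exactly what makes \<open>Delta\<close> of the extended sequence
  nonnegative below \<open>n\<close>.\<close>

lemma graph_with_degree_set:
  assumes n: "n \<ge> 2" and pos: "d n > 0"
    and anti: "\<And>i j. 1 \<le> i \<Longrightarrow> i \<le> j \<Longrightarrow> j \<le> n \<Longrightarrow> d j \<le> d i"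
    and EG: "\<And>k. 1 \<le> k \<Longrightarrow> k \<le> n - 1 \<Longrightarrow> - Delta d n k \<le> int C * int (min k (d n))"
    and ev: "even ((\<Sum>i=1..n. d i) + C * d n)"
  obtains V :: "nat set" and E where "simple_graph V E" "degree_set V E = d ` {1..n}"
    "2 * card E = (\<Sum>i=1..n. d i) + C * d n"
proof -
  define a where "a i = (if i \<le> n then d i else d n)" for i
  have a_anti: "a j \<le> a i" if "1 \<le> i" "i \<le> j" "j \<le> n + C" for i j
    using anti[of i j] anti[of i n] that n by (auto simp: a_def)
  have Delta_a: "Delta a (n + C) k \<ge> 0" if "1 \<le> k" "k \<le> n - 1" for k
    using Delta_extend[of k n d "d n" C] EG[OF that] that by (simp add: a_def[abs_def])
  have EG_a: "Delta a (n + C) k \<ge> 0" if "1 \<le> k" "k \<le> n + C" for k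
    using n pos a_anti _ _ Delta_a that
    by (rule Delta_constant_tail_nonneg) (auto simp: a_def)
  have sl: "slack {1..n+C} a S T \<ge> 0" if "S \<subseteq> {1..n+C}" "T \<subseteq> {1..n+C}" "S \<inter> T = {}" for S T
    using that by (intro slack_nonneg_if_Delta_nonneg a_anti EG_a)
  have sum_a: "(\<Sum>i=1..n+C. a i) = (\<Sum>i=1..n. d i) + C * d n"
  proof -
    have "(\<Sum>i=1..n+C. a i) = (\<Sum>i=1..n. a i) + (\<Sum>i=n+1..n+C. a i)"
      by (intro sum.ub_add_nat) simp
    also have "(\<Sum>i=1..n. a i) = (\<Sum>i=1..n. d i)" by (intro sum.cong) (auto simp: a_def)
    also have "(\<Sum>i=n+1..n+C. a i) = (\<Sum>i=n+1..n+C. d n)" by (intro sum.cong) (auto simp: a_def)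
    finally show ?thesis by simp
  qed
  obtain E where E: "simple_graph {1..n+C} E" "\<forall>v\<in>{1..n+C}. degree E v = a v"
    using Erdos_Gallai_sufficiency[of "{1..n+C}" a] ev sl sum_a by auto
  show ?thesis
  proof (rule that[OF E(1)])
    have "degree_set {1..n+C} E = a ` {1..n+C}" using E(2) by (simp add: degree_set_def)
    also have "\<dots> = d ` {1..n}"
      using n by (auto simp: a_def image_iff)
    finally show "degree_set {1..n+C} E = d ` {1..n}" .
    show "2 * card E = (\<Sum>i=1..n. d i) + C * d n"
      using sum_degree_eq[OF E(1)] E(2) sum_a by simp
  qed
qed

section \<open>Parity correction and the formula for \<open>l_q\<close>\<close>

text \<open>An even \<open>d\<close> forces an even \<open>s\<close>, so the
  \<open>undefined\<close> branch is excluded; for odd \<open>d\<close>, passing from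
  \<open>c\<close> to \<open>c + 1\<close> flips the parity.\<close>

lemma C_star_even:
  assumes "d dvd s"
  shows "even (int s + C_star d s c * int d)"
  using assms by (auto simp: C_star_def algebra_simps elim: dvd_trans)

text \<open>If \<open>c\<close> itself has the wrong parity then \<open>t\<close> differs from
  \<open>c\<close>, so \<open>t\<close> is at least \<open>c + 1\<close>.\<close>

lemma C_star_le:
  assumes "d dvd s" "c \<le> t" "even (int s + t * int d)"
  shows "C_star d s c \<le> t"
proof -
  have "t \<noteq> c" if "odd (int s + c * int d)" using assms(3) that by auto
  then show ?thesis using assms by (auto simp: C_star_def elim: dvd_trans)
qed

lemma C_star_ge:
  assumes "d dvd s"
  shows "c \<le> C_star d s c"
  using assms by (auto simp: C_star_def elim: dvd_trans)

theorem theorem4: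
  fixes D :: "nat set" and d :: "nat \<Rightarrow> nat" and n :: nat and c :: int
  assumes "n \<ge> 2"
    and "D = d ` {1..n}"
    and "\<forall>i\<in>{1..n}. d i > 0"
    and "\<forall>i\<in>{1..n}. \<forall>j\<in>{1..n}. i < j \<longrightarrow> d i > d j"
    and "\<forall>x\<in>D. d n dvd x"
    and "c = Max ((\<lambda>k. \<lceil>- real_of_int (Delta d n k) / real (min k (d n))\<rceil>) ` {1..n-1})"
  shows "real (l_q D)
    = 1/2 * (real (sigma D) + real_of_int (C_star (d n) (sigma D) c) * real (Min D))"
proof -
  define m where "m = d n"
  have m: "m > 0" using assms(1,3) by (simp add: m_def)
  have anti: "d j \<le> d i" if "1 \<le> i" "i \<le> j" "j \<le> n" for i j
    using assms(4) that by (cases "i = j") (auto simp: less_imp_le)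
  have inj: "inj_on d {1..n}"
    using assms(4) by (intro inj_onI) (metis less_irrefl linorder_neqE_nat)
  have sig: "sigma D = (\<Sum>i=1..n. d i)"
    unfolding sigma_def assms(2) sum.reindex[OF inj] by simp
  have MinD: "Min D = m"
    unfolding assms(2) m_def using anti assms(1) by (intro Min_eqI) auto
  have dvd: "m dvd d i" if "i \<in> {1..n}" for i using assms(2,5) that by (auto simp: m_def)
  then have dvds: "m dvd sigma D" unfolding sig by (intro dvd_sum) auto
  \<comment> \<open>Maximum and ceiling disappear: an integer bounds \<open>c\<close> from above iff
    it satisfies finitely many linear inequalities, the form in which both bounds are
    proved.\<close>
  have c_le_iff: "c \<le> z \<longleftrightarrow> (\<forall>k\<in>{1..n-1}. - Delta d n k \<le> z * int (min k m))" for z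
  proof -
    have "\<lceil>- real_of_int (Delta d n k) / real (min k m)\<rceil> \<le> z \<longleftrightarrow> - Delta d n k \<le> z * int (min k m)"
      if "k \<in> {1..n-1}" for k
    proof -
      have "real (min k m) > 0" using that m by simp
      then have "\<lceil>- real_of_int (Delta d n k) / real (min k m)\<rceil> \<le> z
          \<longleftrightarrow> - real_of_int (Delta d n k) \<le> real_of_int z * real (min k m)"
        by (simp only: ceiling_le_iff pos_divide_le_eq)
      also have "\<dots> \<longleftrightarrow> real_of_int (- Delta d n k) \<le> real_of_int (z * int (min k m))" by simp
      finally show ?thesis by (simp only: of_int_le_iff)
    qed
    then show ?thesis unfolding assms(6) m_def[symmetric] using assms(1) by simp
  qed
  \<comment> \<open>Needed for \<open>nat\<close> in the definition of \<open>C\<close> to be exact.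
    The \<open>n\<close> distinct positive values lie in \<open>{1..d 1}\<close>, so
    \<open>d 1 \<ge> n\<close>, and the case \<open>k = 1\<close> gives the sign.\<close>
  have "c \<ge> 0"
  proof -
    have "d ` {1..n} \<subseteq> {1..d 1}"
      using anti[of 1] assms(3) by (auto simp: Suc_le_eq)
    from card_inj_on_le[OF inj this] have "n \<le> d 1" by simp
    moreover have "(\<Sum>i=Suc 1..n. int (min 1 (d i))) \<le> (\<Sum>i=Suc 1..n. 1)"
      by (intro sum_mono) simp
    ultimately have "- Delta d n 1 \<ge> 0" by (simp add: Delta_def)
    moreover have "- Delta d n 1 \<le> c * int (min 1 m)"
      using c_le_iff[of c] assms(1) by auto
    ultimately show ?thesis using m by simp
  qed
  define C where "C = nat (C_star m (sigma D) c)"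
  have C: "int C = C_star m (sigma D) c"
    using C_star_ge[OF dvds, of c] \<open>c \<ge> 0\<close> by (simp add: C_def)
  have "even (int (sigma D + C * m))" using C_star_even[OF dvds, of c] C by simp
  then have ev: "even ((\<Sum>i=1..n. d i) + C * d n)" by (simp only: sig m_def even_of_nat)
  have EG: "- Delta d n k \<le> int C * int (min k (d n))" if "1 \<le> k" "k \<le> n - 1" for k
    using c_le_iff[of "int C"] C_star_ge[OF dvds, of c] C that by (simp add: m_def)
  have dn: "d n > 0" using m by (simp add: m_def)
  obtain V :: "nat set" and E where VE: "simple_graph V E" "degree_set V E = d ` {1..n}"
    "2 * card E = (\<Sum>i=1..n. d i) + C * d n"
    using graph_with_degree_set[OF assms(1) dn anti EG ev] by blast
  have upper: "l_q D \<le> card E" using l_q_le[OF VE(1)] VE(2) assms(2) by simp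
  have "\<exists>(V :: nat set) E. simple_graph V E \<and> degree_set V E = D \<and> card E = l_q D"
    unfolding l_q_def by (rule LeastI_ex) (use VE assms(2) in blast)
  then obtain V' :: "nat set" and E' where G': "simple_graph V' E'" "degree_set V' E' = d ` {1..n}"
    and card': "card E' = l_q D" using assms(2) by auto
  obtain t where t: "2 * card E' = (\<Sum>i=1..n. d i) + t * m"
    "\<And>k. 1 \<le> k \<Longrightarrow> k \<le> n \<Longrightarrow> - Delta d n k \<le> int t * int (min k m)"
    using edges_of_degree_set[OF G' inj dvd] by blast
  have "c \<le> int t" unfolding c_le_iff using t(2) by auto
  moreover have "even (int (sigma D + t * m))" unfolding sig t(1)[symmetric] by simp
  ultimately have "int C \<le> int t" unfolding C by (intro C_star_le[OF dvds]) auto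
  then have "C * m \<le> t * m" by simp
  \<comment> \<open>The constructed graph has at least \<open>l_q D\<close> edges, while a minimal
    graph has excess \<open>t * m \<ge> C * m\<close>, so equality holds.\<close>
  then have "2 * l_q D = sigma D + C * m"
    using upper VE(3) t(1) unfolding sig m_def card' by linarith
  then have "2 * real (l_q D) = real (sigma D) + real C * real m"
    by (metis of_nat_add of_nat_mult of_nat_numeral)
  moreover have "real C = real_of_int (C_star m (sigma D) c)" using C by (metis of_int_of_nat_eq)
  ultimately show ?thesis unfolding MinD m_def[symmetric] by simp
qed

end
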